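(* Let $f_1,\dots,f_N:\mathbb R^n\to\mathbb R\cup\{+\infty\}$ be closed, proper and strictly convex, and suppose that the consensus problem $\min_{x_1,\dots,x_N,z}\sum_{i=1}^N f_i(x_i)$ s.t. $x_i=z$ for all $i$ has a solution $z^*$, with associated optimal dual variables $\lambda^*=(\lambda_1^*,\dots,\lambda_N^* )$, so that along the iterations of Reduced Consensus ALADIN $$\mathscr L(z,\lambda)-\mathscr L(z^+,\lambda^+)\ge\alpha(\|x_i^+-z^*\|)\ge0\quad\text{for every } i,$$ for a class $\mathcal K$ function $\alpha$, where $\mathscr L(z,\lambda)=\frac1\rho\sum_{i=1}^N\|\lambda_i-\lambda_i^*\|^2+\rho N\|z-z^*\|^2$. Then, for every $i$, the local iterates $x_i$ generated by Reduced Consensus ALADIN converge to $z^*$.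
   Context: $\|\cdot\|$ is the Euclidean norm and $\rho>0$ is a fixed parameter. One iteration of Reduced Consensus ALADIN maps $(z,\lambda)$, with $z\in\mathbb R^n$, $\lambda=(\lambda_1,\dots,\lambda_N)\in(\mathbb R^n)^N$ and $\sum_{i=1}^N\lambda_i=0$, to $(z^+,\lambda^+)$ by $$x_i^+=\arg\min_{x_i} f_i(x_i)+\lambda_i^\top x_i+\tfrac{\rho}{2}\|x_i-z\|^2,\qquad g_i=\rho(z-x_i^+)-\lambda_i,$$ $$z^+=\frac1N\sum_{i=1}^N\Big(x_i^+-\frac{g_i}{\rho}\Big),\qquad \lambda_i^+=\rho(x_i^+-z^+)-g_i .$$ The local iterates are the successive points $x_i^+$. The update preserves $\sum_i\lambda_i=0$. Optimal dual variables are multipliers $\lambda_i^*$ of the constraints $x_i=z$ satisfying, together with $z^*$, the optimality conditions $-\lambda_i^*\in\partial f_i(z^* )$ for all $i$ and $\sum_{i=1}^N\lambda_i^*=0$. A class $\mathcal K$ function is a continuous, strictly increasing function $\alpha:[0,\infty)\to[0,\infty)$ with $\alpha(0)=0$. *)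

theory Defs
  imports "HOL-Analysis.Analysis"
begin

text \<open>
  Functions into \<open>\<real> \<union> {+\<infinity>}\<close> are \<^typ>\<open>ereal\<close>-valued functions; the value
  \<open>-\<infinity>\<close> is excluded by properness.
\<close>

definition proper_fun :: "('a \<Rightarrow> ereal) \<Rightarrow> bool" where
  "proper_fun f \<longleftrightarrow> (\<forall>x. f x \<noteq> -\<infinity>) \<and> (\<exists>x. f x \<noteq> \<infinity>)"

definition closed_fun :: "('a::topological_space \<Rightarrow> ereal) \<Rightarrow> bool" where
  "closed_fun f \<longleftrightarrow> closed {(x, t::real). f x \<le> ereal t}"

text \<open>
  The strict inequality is only required on the effective domain. Off it, the right-hand side
  would be \<open>+\<infinity>\<close> and the inequality could fail by being an equality.
\<close>

definition strictly_convex_fun :: "('a::real_vector \<Rightarrow> ereal) \<Rightarrow> bool" where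
  "strictly_convex_fun f \<longleftrightarrow>
     (\<forall>x y. \<forall>t::real. f x < \<infinity> \<longrightarrow> f y < \<infinity> \<longrightarrow> x \<noteq> y \<longrightarrow> 0 < t \<longrightarrow> t < 1 \<longrightarrow>
        f ((1 - t) *\<^sub>R x + t *\<^sub>R y) < ereal (1 - t) * f x + ereal t * f y)"

text \<open>
  For proper \<open>f\<close> this set is empty where \<open>f x = \<infinity>\<close>.
\<close>

definition subdifferential :: "('a::real_inner \<Rightarrow> ereal) \<Rightarrow> 'a \<Rightarrow> 'a set" where
  "subdifferential f x = {g. \<forall>y. f y \<ge> f x + ereal (g \<bullet> (y - x))}"

definition class_K :: "(real \<Rightarrow> real) \<Rightarrow> bool" where
  "class_K \<alpha> \<longleftrightarrow> \<alpha> ` {0..} \<subseteq> {0..} \<and> continuous_on {0..} \<alpha> \<and> strict_mono_on {0..} \<alpha> \<and> \<alpha> 0 = 0"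

text \<open>
  Families \<open>f\<^sub>1, \<dots>, f\<^sub>N\<close> are functions on \<^typ>\<open>nat\<close> of which only the values at
  \<open>1, \<dots>, N\<close> are ever used.
\<close>

definition consensus_solution ::
    "nat \<Rightarrow> (nat \<Rightarrow> 'a \<Rightarrow> ereal) \<Rightarrow> 'a \<Rightarrow> bool" where
  "consensus_solution N f zs \<longleftrightarrow>
     is_arg_min (\<lambda>(x, z). \<Sum>i=1..N. f i (x i)) (\<lambda>(x, z). \<forall>i\<in>{1..N}. x i = z) (\<lambda>i. zs, zs)"

definition optimal_duals ::
    "nat \<Rightarrow> (nat \<Rightarrow> 'a::real_inner \<Rightarrow> ereal) \<Rightarrow> 'a \<Rightarrow> (nat \<Rightarrow> 'a) \<Rightarrow> bool" where
  "optimal_duals N f zs ls \<longleftrightarrow>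
     (\<forall>i\<in>{1..N}. - ls i \<in> subdifferential (f i) zs) \<and> (\<Sum>i=1..N. ls i) = 0"

text \<open>
  One iteration from \<open>(z, l)\<close> to \<open>(z', l')\<close> with local minimisers \<open>x\<close>. The step is a
  relation, so no choice operator stands for the (unique) minimisers.
\<close>

definition aladin_step ::
    "nat \<Rightarrow> (nat \<Rightarrow> 'a::real_inner \<Rightarrow> ereal) \<Rightarrow> real \<Rightarrow>
     'a \<Rightarrow> (nat \<Rightarrow> 'a) \<Rightarrow> (nat \<Rightarrow> 'a) \<Rightarrow> 'a \<Rightarrow> (nat \<Rightarrow> 'a) \<Rightarrow> bool" where
  "aladin_step N f \<rho> z l x z' l' \<longleftrightarrow>
     (let g = (\<lambda>i. \<rho> *\<^sub>R (z - x i) - l i) in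
       (\<forall>i\<in>{1..N}.
          is_arg_min (\<lambda>u. f i u + ereal (l i \<bullet> u) + ereal (\<rho> / 2 * (norm (u - z))\<^sup>2))
            (\<lambda>u. True) (x i)) \<and>
       z' = (1 / real N) *\<^sub>R (\<Sum>i=1..N. x i - (1 / \<rho>) *\<^sub>R g i) \<and>
       (\<forall>i\<in>{1..N}. l' i = \<rho> *\<^sub>R (x i - z') - g i))"

text \<open>
  \<open>x k\<close> collects the local minimisers computed from \<open>(z k, l k)\<close>. The constraint
  \<open>\<Sum>\<^sub>i \<lambda>\<^sub>i = 0\<close> is imposed on the initial multipliers only, as every step yields it again.
\<close>

definition aladin_run ::
    "nat \<Rightarrow> (nat \<Rightarrow> 'a::real_inner \<Rightarrow> ereal) \<Rightarrow> real \<Rightarrow>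
     (nat \<Rightarrow> 'a) \<Rightarrow> (nat \<Rightarrow> nat \<Rightarrow> 'a) \<Rightarrow> (nat \<Rightarrow> nat \<Rightarrow> 'a) \<Rightarrow> bool" where
  "aladin_run N f \<rho> z l x \<longleftrightarrow>
     (\<Sum>i=1..N. l 0 i) = 0 \<and>
     (\<forall>k. aladin_step N f \<rho> (z k) (l k) (x k) (z (Suc k)) (l (Suc k)))"

definition lyapunov ::
    "nat \<Rightarrow> real \<Rightarrow> 'a::real_inner \<Rightarrow> (nat \<Rightarrow> 'a) \<Rightarrow> 'a \<Rightarrow> (nat \<Rightarrow> 'a) \<Rightarrow> real" where
  "lyapunov N \<rho> zs ls z l =
     1 / \<rho> * (\<Sum>i=1..N. (norm (l i - ls i))\<^sup>2) + \<rho> * real N * (norm (z - zs))\<^sup>2"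

end

theory Submission
  imports Defs
begin

text \<open>
  Write \<open>g\<^sub>i\<close> for the subgradient of \<open>f\<^sub>i\<close> that the optimality of \<open>x\<^sub>i\<^sup>+\<close> provides. A step sends
  \<open>\<rho> z - \<lambda>\<^sub>i = \<rho> x\<^sub>i\<^sup>+ + g\<^sub>i\<close> to \<open>\<rho> z\<^sup>+ + \<lambda>\<^sub>i\<^sup>+ = \<rho> x\<^sub>i\<^sup>+ - g\<^sub>i\<close>, so it is a reflection in the style of
  Peaceman and Rachford. Since the multipliers sum to zero, the cross terms between \<open>z\<close> and \<open>\<lambda>\<close>
  cancel, and \<open>\<rho>\<close> times the Lyapunov function is the squared distance of these vectors
  from their values at the optimum. The polarisation identity
  \<open>\<parallel>a + b\<parallel>\<^sup>2 - \<parallel>a - b\<parallel>\<^sup>2 = 4 a \<bullet> b\<close> then gives the exact decrease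
  \<open>4 (\<Sum>i. (x\<^sub>i\<^sup>+ - z\<^sup>*) \<bullet> (g\<^sub>i + \<lambda>\<^sub>i\<^sup>*))\<close> (\<open>lyapunov_decrease\<close>), whose terms are
  nonnegative because subdifferentials are monotone.

  Each term is moreover bounded below by the gap \<open>f\<^sub>i x - f\<^sub>i z\<^sup>* + \<lambda>\<^sub>i\<^sup>* \<bullet> (x - z\<^sup>*)\<close> of \<open>f\<^sub>i\<close> above
  its supporting hyperplane at \<open>z\<^sup>*\<close>. Strict convexity makes the gap positive off \<open>z\<^sup>*\<close>,
  compactness of a sphere around \<open>z\<^sup>*\<close> and closedness make it uniformly positive on the sphere,
  and convexity extends the bound to everything outside the sphere
  (\<open>strictly_convex_uniform_monotonicity\<close>). A pointwise positive bound of this kind can always be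
  sharpened to a class \<open>\<K>\<close> function (\<open>class_K_minorant\<close>), and this function depends neither
  on the run nor on the iteration.

  The Lyapunov function is nonnegative and nonincreasing, hence its decrements tend to zero; a
  class \<open>\<K>\<close> function that tends to zero along a sequence forces its argument to zero.
\<close>

section \<open>Class \<open>\<K>\<close> functions\<close>

text \<open>
  The infimal convolution with \<open>s \<mapsto> max 0 s\<close> yields a minorant that is Lipschitz and
  nondecreasing, and still positive on positive arguments. The factor \<open>r / (1 + r)\<close>,
  which lies between \<open>0\<close> and \<open>1\<close>, makes it strictly increasing. The pair
  \<open>(0, 0)\<close> only ensures that the infimum ranges over a nonempty set.
\<close>

lemma class_K_minorant:
  fixes P :: "(real \<times> real) set"
  assumes nonneg: "\<And>s d. (s, d) \<in> P \<Longrightarrow> 0 \<le> s \<and> 0 \<le> d"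
    and pos: "\<And>r. 0 < r \<Longrightarrow> \<exists>c>0. \<forall>(s, d)\<in>P. r \<le> s \<longrightarrow> c \<le> d"
  shows "\<exists>\<alpha>. class_K \<alpha> \<and> (\<forall>(s, d)\<in>P. \<alpha> s \<le> d)"
proof -
  define Q where "Q = insert (0, 0) P"
  define \<beta> where "\<beta> r = (INF p\<in>Q. snd p + max 0 (r - fst p))" for r :: real
  define \<alpha> where "\<alpha> r = \<beta> r * (r / (1 + r))" for r
  have Q_ne: "Q \<noteq> {}"
    by (simp add: Q_def)
  have bdd: "bdd_below ((\<lambda>p. snd p + max 0 (r - fst p)) ` Q)" for r
    by (rule bdd_belowI[of _ 0]) (use nonneg in \<open>force simp: Q_def\<close>)
  have lower: "\<beta> r \<le> snd p + max 0 (r - fst p)" if "p \<in> Q" for p r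
    unfolding \<beta>_def by (rule cINF_lower[OF bdd that])
  have \<beta>_shift: "\<beta> r \<le> \<beta> r' + max 0 (r - r')" for r r'
  proof -
    have "\<beta> r - max 0 (r - r') \<le> (INF p\<in>Q. snd p + max 0 (r' - fst p))"
      by (rule cINF_greatest[OF Q_ne], use lower in \<open>smt (verit)\<close>)
    then show ?thesis
      by (simp add: \<beta>_def[of r'])
  qed
  have \<beta>_mono: "\<beta> r \<le> \<beta> r'" if "r \<le> r'" for r r'
    using \<beta>_shift[of r r'] that by simp
  have \<beta>_pos: "0 < \<beta> r" if "0 < r" for r
  proof -
    obtain c where "c > 0" and c: "\<forall>(s, d)\<in>P. r / 2 \<le> s \<longrightarrow> c \<le> d"
      using pos[of "r / 2"] half_gt_zero[OF \<open>0 < r\<close>] by blast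
    have "min c (r / 2) \<le> \<beta> r"
      unfolding \<beta>_def
    proof (rule cINF_greatest[OF Q_ne])
      fix p assume "p \<in> Q"
      then consider "p = (0, 0)" | "p \<in> P"
        by (auto simp: Q_def)
      then show "min c (r / 2) \<le> snd p + max 0 (r - fst p)"
      proof cases
        case 2
        then show ?thesis
          using nonneg[of "fst p" "snd p"] bspec[OF c 2]
          by (cases "r / 2 \<le> fst p") (auto simp: case_prod_unfold)
      qed (use that in auto)
    qed
    then show ?thesis
      using \<open>c > 0\<close> that by linarith
  qed
  have \<beta>_nonneg: "0 \<le> \<beta> r" for r
    unfolding \<beta>_def
    by (rule cINF_greatest[OF Q_ne]) (use nonneg in \<open>force simp: Q_def\<close>)
  have "1-lipschitz_on {0..} \<beta>"
  proof (rule lipschitz_onI)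
    fix r r' :: real
    show "dist (\<beta> r) (\<beta> r') \<le> 1 * dist r r'"
      using \<beta>_shift[of r r'] \<beta>_shift[of r' r] by (simp add: dist_real_def)
  qed simp
  then have "continuous_on {0..} \<beta>"
    by (rule lipschitz_on_continuous_on)
  then have cont: "continuous_on {0..} \<alpha>"
    unfolding \<alpha>_def by (auto intro!: continuous_intros)
  have strict: "strict_mono_on {0..} \<alpha>"
  proof (rule strict_mono_onI)
    fix r r' :: real assume rr: "r \<in> {0..}" "r' \<in> {0..}" "r < r'"
    have "\<beta> r * (r / (1 + r)) \<le> \<beta> r' * (r / (1 + r))"
      using \<beta>_mono[of r r'] rr by (intro mult_right_mono) auto
    also have "\<dots> < \<beta> r' * (r' / (1 + r'))"
      using \<beta>_pos[of r'] rr by (intro mult_strict_left_mono) (auto simp: field_simps)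
    finally show "\<alpha> r < \<alpha> r'"
      by (simp add: \<alpha>_def)
  qed
  have "class_K \<alpha>"
    unfolding class_K_def using cont strict \<beta>_nonneg by (auto simp: \<alpha>_def)
  moreover have "\<alpha> s \<le> d" if "(s, d) \<in> P" for s d
  proof -
    have "\<alpha> s \<le> \<beta> s * 1"
      unfolding \<alpha>_def using nonneg[OF that] \<beta>_nonneg
      by (intro mult_left_mono) (auto simp: divide_simps)
    also have "\<dots> \<le> d"
      using lower[of "(s, d)" s] that by (simp add: Q_def)
    finally show ?thesis .
  qed
  ultimately show ?thesis
    by blast
qed

lemma class_K_nonneg:
  assumes "class_K \<alpha>" "0 \<le> r"
  shows "0 \<le> \<alpha> r"
  using assms by (auto simp: class_K_def)

lemma class_K_tendsto_zeroD:
  fixes r :: "nat \<Rightarrow> real"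
  assumes K: "class_K \<alpha>" and nonneg: "\<And>k. 0 \<le> r k"
    and lim: "(\<lambda>k. \<alpha> (r k)) \<longlonglongrightarrow> 0"
  shows "r \<longlonglongrightarrow> 0"
proof (rule order_tendstoI)
  fix e :: real assume "0 < e"
  have mono: "strict_mono_on {0..} \<alpha>" and "\<alpha> 0 = 0"
    using K by (auto simp: class_K_def)
  then have "0 < \<alpha> e"
    using strict_mono_onD[OF mono, of 0 e] \<open>0 < e\<close> by simp
  with lim have "\<forall>\<^sub>F k in sequentially. \<alpha> (r k) < \<alpha> e"
    by (rule order_tendstoD(2))
  then show "\<forall>\<^sub>F k in sequentially. r k < e"
  proof (rule eventually_mono)
    fix k assume "\<alpha> (r k) < \<alpha> e"
    then show "r k < e"
      using strict_mono_on_leD[OF mono, of e "r k"] nonneg[of k] \<open>0 < e\<close> by force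
  qed
next
  fix e :: real assume "e < 0"
  then show "\<forall>\<^sub>F k in sequentially. e < r k"
    using nonneg by (auto intro!: always_eventually intro: less_le_trans)
qed

lemma decrements_bound_tendsto_zero:
  fixes L d :: "nat \<Rightarrow> real"
  assumes "\<And>k. 0 \<le> L k" "\<And>k. 0 \<le> d k" "\<And>k. d k \<le> L k - L (Suc k)"
  shows "d \<longlonglongrightarrow> 0"
proof -
  have "decseq L"
    by (rule decseq_SucI) (use assms(2,3) in \<open>smt (verit)\<close>)
  then obtain c where c: "L \<longlonglongrightarrow> c"
    using decseq_convergent[of L 0] assms(1) by blast
  have "(\<lambda>k. L k - L (Suc k)) \<longlonglongrightarrow> c - c"
    by (intro tendsto_diff c LIMSEQ_Suc)
  then have lim: "(\<lambda>k. L k - L (Suc k)) \<longlonglongrightarrow> 0"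
    by simp
  show ?thesis
    by (rule tendsto_sandwich[OF _ _ tendsto_const lim]) (use assms in auto)
qed

section \<open>Subgradients of strictly convex functions\<close>

lemma subdifferential_finite:
  assumes "proper_fun f" "g \<in> subdifferential f x"
  shows "\<bar>f x\<bar> \<noteq> \<infinity>"
proof -
  obtain y where "f y \<noteq> \<infinity>"
    using assms(1) by (auto simp: proper_fun_def)
  moreover have "f y \<ge> f x + ereal (g \<bullet> (y - x))"
    using assms(2) by (auto simp: subdifferential_def)
  ultimately have "f x \<noteq> \<infinity>"
    by auto
  then show ?thesis
    using assms(1) by (auto simp: proper_fun_def)
qed

lemma subdifferential_monotone:
  assumes "proper_fun f" "g \<in> subdifferential f x" "h \<in> subdifferential f z"
  shows "0 \<le> (x - z) \<bullet> (g - h)"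
proof -
  obtain a b where ab: "f x = ereal a" "f z = ereal b"
    using subdifferential_finite[OF assms(1,2)] subdifferential_finite[OF assms(1,3)] by auto
  have "f z \<ge> f x + ereal (g \<bullet> (z - x))" "f x \<ge> f z + ereal (h \<bullet> (x - z))"
    using assms(2,3) by (auto simp: subdifferential_def)
  then show ?thesis
    by (simp add: ab inner_diff_left inner_diff_right inner_commute)
qed

lemma strictly_convex_segment_le:
  assumes conv: "strictly_convex_fun f"
    and fx: "f x = ereal a" and fy: "f y = ereal b" and t: "0 < t" "t \<le> 1"
  shows "f ((1 - t) *\<^sub>R x + t *\<^sub>R y) \<le> ereal ((1 - t) * a + t * b)"
proof (cases "x = y \<or> t = 1")
  case True
  then show ?thesis
  proof
    assume "x = y"
    then have "(1 - t) *\<^sub>R x + t *\<^sub>R y = x" and "b = a"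
      using fx fy by (simp_all flip: scaleR_add_left)
    moreover have "(1 - t) * a + t * a = a"
      by (simp add: algebra_simps)
    ultimately show ?thesis
      using fx by simp
  qed (use fy in simp)
next
  case False
  then have "f ((1 - t) *\<^sub>R x + t *\<^sub>R y) < ereal (1 - t) * f x + ereal t * f y"
    by (intro conv[unfolded strictly_convex_fun_def, rule_format]) (use t in \<open>auto simp: fx fy\<close>)
  then show ?thesis
    by (simp add: fx fy)
qed

text \<open>
  Comparing the minimiser with the points \<open>x + t (y - x)\<close> of a segment gives the subgradient
  inequality up to an error \<open>\<rho> / 2 * t * \<parallel>y - x\<parallel>\<^sup>2\<close>, which vanishes as \<open>t\<close> tends to \<open>0\<close>.
\<close>

lemma proximal_optimality:
  fixes f :: "'a::real_inner \<Rightarrow> ereal"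
  assumes proper: "proper_fun f" and conv: "strictly_convex_fun f"
    and min: "is_arg_min (\<lambda>u. f u + ereal (l \<bullet> u) + ereal (\<rho> / 2 * (norm (u - z))\<^sup>2))
                (\<lambda>u. True) x"
  shows "\<rho> *\<^sub>R (z - x) - l \<in> subdifferential f x"
proof -
  have le: "f x + ereal (l \<bullet> x) + ereal (\<rho> / 2 * (norm (x - z))\<^sup>2)
      \<le> f u + ereal (l \<bullet> u) + ereal (\<rho> / 2 * (norm (u - z))\<^sup>2)" for u
    using min by (auto simp: is_arg_min_def not_less)
  obtain w where "f w \<noteq> \<infinity>"
    using proper by (auto simp: proper_fun_def)
  then have "f x \<noteq> \<infinity>"
    using le[of w] by auto
  then obtain a where a: "f x = ereal a"
    using proper by (cases "f x") (auto simp: proper_fun_def)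
  have "f x + ereal ((\<rho> *\<^sub>R (z - x) - l) \<bullet> (y - x)) \<le> f y" for y
  proof (cases "f y")
    case (real b)
    define q where "q = (\<rho> *\<^sub>R (z - x) - l) \<bullet> (y - x)"
    have quotient: "a + q \<le> b + t * (\<rho> / 2 * (norm (y - x))\<^sup>2)" if t: "0 < t" "t < 1" for t
    proof -
      define u where "u = (1 - t) *\<^sub>R x + t *\<^sub>R y"
      have u: "u - z = (x - z) + t *\<^sub>R (y - x)" "u = x + t *\<^sub>R (y - x)"
        by (simp_all add: u_def algebra_simps)
      have "f u \<le> ereal ((1 - t) * a + t * b)"
        unfolding u_def by (rule strictly_convex_segment_le[OF conv a real]) (use t in auto)
      then obtain c where c: "f u = ereal c" "c \<le> (1 - t) * a + t * b"
        using proper by (cases "f u") (auto simp: proper_fun_def)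
      have sq: "(norm (u - z))\<^sup>2
          = (norm (x - z))\<^sup>2 + 2 * t * ((x - z) \<bullet> (y - x)) + t\<^sup>2 * (norm (y - x))\<^sup>2"
        unfolding u(1) power2_norm_eq_inner
        by (simp add: inner_add_left inner_add_right inner_commute power2_eq_square)
      have lu: "l \<bullet> u = l \<bullet> x + t * (l \<bullet> (y - x))"
        by (simp add: u(2) inner_add_right)
      have "a + l \<bullet> x + \<rho> / 2 * (norm (x - z))\<^sup>2 \<le> c + l \<bullet> u + \<rho> / 2 * (norm (u - z))\<^sup>2"
        using le[of u] by (simp add: a c)
      then have "0 \<le> t * (b - a) + t * (l \<bullet> (y - x)) + \<rho> * t * ((x - z) \<bullet> (y - x))
          + \<rho> / 2 * t\<^sup>2 * (norm (y - x))\<^sup>2"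
        using c(2) unfolding sq lu by (simp add: algebra_simps)
      also have "\<dots> = t * (b + t * (\<rho> / 2 * (norm (y - x))\<^sup>2) - (a + q))"
        by (simp add: q_def inner_diff_left power2_eq_square algebra_simps)
      finally show ?thesis
        using t by (simp add: zero_le_mult_iff)
    qed
    have lim: "((\<lambda>t. b + t * (\<rho> / 2 * (norm (y - x))\<^sup>2)) \<longlongrightarrow> b + 0 * (\<rho> / 2 * (norm (y - x))\<^sup>2))
        (at_right 0)"
      by (intro tendsto_intros)
    have "\<forall>\<^sub>F t in at_right 0. a + q \<le> b + t * (\<rho> / 2 * (norm (y - x))\<^sup>2)"
      unfolding eventually_at_right_field
      by (intro exI[of _ 1] conjI allI impI quotient zero_less_one)
    then have "a + q \<le> b + 0 * (\<rho> / 2 * (norm (y - x))\<^sup>2)"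
      by (rule tendsto_lowerbound[OF lim]) simp
    then show ?thesis
      by (simp add: a real q_def)
  qed (use proper in \<open>auto simp: proper_fun_def\<close>)
  then show ?thesis
    by (simp add: subdifferential_def)
qed

text \<open>
  At the midpoint of \<open>z\<close> and \<open>u\<close> strict convexity pushes the function strictly below the chord,
  while the subgradient inequality keeps it above the hyperplane.
\<close>

lemma strictly_convex_above_hyperplane:
  assumes conv: "strictly_convex_fun f" and h: "h \<in> subdifferential f z"
    and fz: "f z = ereal b" and fu: "f u \<le> ereal t" and ne: "u \<noteq> z"
  shows "b + h \<bullet> (u - z) < t"
proof -
  have sub: "f z + ereal (h \<bullet> (y - z)) \<le> f y" for y
    using h by (auto simp: subdifferential_def)
  obtain s where s: "f u = ereal s" "s \<le> t"
    using sub[of u] fu by (cases "f u") (auto simp: fz)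
  define m where "m = (1 - 1 / 2) *\<^sub>R z + (1 / 2 :: real) *\<^sub>R u"
  have "f m < ereal (1 - 1 / 2) * f z + ereal (1 / 2) * f u"
    unfolding m_def
    by (rule conv[unfolded strictly_convex_fun_def, rule_format]) (use ne in \<open>auto simp: fz s\<close>)
  then have "f m < ereal (b / 2 + s / 2)"
    by (simp add: fz s)
  moreover have "m - z = (1 / 2 :: real) *\<^sub>R (u - z)"
    by (simp add: m_def algebra_simps flip: scaleR_add_left)
  then have "ereal (b + h \<bullet> (u - z) / 2) \<le> f m"
    using sub[of m] by (simp add: fz)
  ultimately have "ereal (b + h \<bullet> (u - z) / 2) < ereal (b / 2 + s / 2)"
    by (rule le_less_trans[rotated])
  then show ?thesis
    using s(2) by simp
qed

text \<open>
  The part of the epigraph over the sphere that lies within height \<open>1\<close> above the hyperplane is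
  compact, so the height attains a positive minimum there; whatever it misses is at least \<open>1\<close>
  above the hyperplane.
\<close>

lemma strictly_convex_sphere_gap:
  fixes f :: "'a::euclidean_space \<Rightarrow> ereal"
  assumes closed: "closed_fun f" and conv: "strictly_convex_fun f"
    and h: "h \<in> subdifferential f z" and fz: "f z = ereal b" and r: "0 < r"
  shows "\<exists>c>0. \<forall>u t. dist z u = r \<longrightarrow> f u \<le> ereal t \<longrightarrow> c \<le> t - (b + h \<bullet> (u - z))"
proof -
  define gap where "gap = (\<lambda>(u, t). t - (b + h \<bullet> (u - z)))"
  define K where "K = {(u, t). f u \<le> ereal t} \<inter> {p. dist z (fst p) = r} \<inter> {p. gap p \<le> 1}"
  have gap_pos: "0 < gap (u, t)" if "f u \<le> ereal t" "dist z u = r" for u t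
    using strictly_convex_above_hyperplane[OF conv h fz that(1)] that(2) r
    by (auto simp: gap_def)
  have gap_cont: "continuous_on UNIV gap"
    unfolding gap_def case_prod_unfold by (intro continuous_intros)
  have "closed K"
    unfolding K_def using closed gap_cont
    by (intro closed_Int closed_Collect_eq closed_Collect_le continuous_intros)
      (simp_all add: closed_fun_def)
  moreover have "K \<subseteq> cball z r \<times> cball b (1 + norm h * r)"
  proof (rule subsetI)
    fix p assume p: "p \<in> K"
    obtain u t where [simp]: "p = (u, t)"
      by (cases p)
    have u: "dist z u = r" "f u \<le> ereal t" "gap (u, t) \<le> 1"
      using p by (auto simp: K_def)
    have "\<bar>h \<bullet> (u - z)\<bar> \<le> norm h * r"
      using Cauchy_Schwarz_ineq2[of h "u - z"] u(1) by (simp add: dist_norm norm_minus_commute)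
    then show "p \<in> cball z r \<times> cball b (1 + norm h * r)"
      using u gap_pos[OF u(2,1)] by (auto simp: gap_def dist_real_def)
  qed
  then have "bounded K"
    by (rule bounded_subset[rotated]) (intro bounded_Times bounded_cball)
  ultimately have "compact K"
    by (simp add: compact_eq_bounded_closed)
  have outside: "1 \<le> gap (u, t)" if "f u \<le> ereal t" "dist z u = r" "(u, t) \<notin> K" for u t
    using that by (auto simp: K_def)
  show ?thesis
  proof (cases "K = {}")
    case True
    then show ?thesis
      using outside by (intro exI[of _ 1]) (auto simp: gap_def)
  next
    case False
    have "continuous_on K gap"
      using gap_cont by (rule continuous_on_subset) simp
    from continuous_attains_inf[OF \<open>compact K\<close> False this]
    obtain p where p: "p \<in> K" "\<And>q. q \<in> K \<Longrightarrow> gap p \<le> gap q"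
      by blast
    have "0 < gap p"
      using p(1) gap_pos by (auto simp: K_def)
    moreover have "min 1 (gap p) \<le> gap (u, t)" if "dist z u = r" "f u \<le> ereal t" for u t
      using p(2)[of "(u, t)"] outside[of u t] that by fastforce
    ultimately show ?thesis
      by (intro exI[of _ "min 1 (gap p)"]) (auto simp: gap_def)
  qed
qed

text \<open>
  Along the ray from \<open>z\<close> through \<open>x\<close> the gap above the hyperplane grows at least linearly by
  convexity, so its bound on the sphere persists outside. The subgradient inequality at \<open>x\<close>
  turns the gap into a bound on the inner product.
\<close>

lemma strictly_convex_uniform_monotonicity:
  fixes f :: "'a::euclidean_space \<Rightarrow> ereal"
  assumes closed: "closed_fun f" and proper: "proper_fun f" and conv: "strictly_convex_fun f"
    and h: "h \<in> subdifferential f z" and r: "0 < r"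
  shows "\<exists>c>0. \<forall>x g. g \<in> subdifferential f x \<longrightarrow> r \<le> norm (x - z) \<longrightarrow> c \<le> (x - z) \<bullet> (g - h)"
proof -
  obtain b where b: "f z = ereal b"
    using subdifferential_finite[OF proper h] by auto
  obtain c where c: "c > 0"
      "\<And>u t. dist z u = r \<Longrightarrow> f u \<le> ereal t \<Longrightarrow> c \<le> t - (b + h \<bullet> (u - z))"
    using strictly_convex_sphere_gap[OF closed conv h b r] by blast
  have "c \<le> (x - z) \<bullet> (g - h)" if g: "g \<in> subdifferential f x" and x: "r \<le> norm (x - z)" for x g
  proof -
    obtain a where a: "f x = ereal a"
      using subdifferential_finite[OF proper g] by auto
    define t where "t = r / norm (x - z)"
    have t: "0 < t" "t \<le> 1"
      using r x by (auto simp: t_def divide_simps)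
    define u where "u = (1 - t) *\<^sub>R z + t *\<^sub>R x"
    have u: "u - z = t *\<^sub>R (x - z)"
      by (simp add: u_def algebra_simps)
    have "dist z u = norm (u - z)"
      by (simp add: dist_norm norm_minus_commute)
    also have "\<dots> = r"
      unfolding u using r x t by (auto simp: t_def)
    finally have "c \<le> (1 - t) * b + t * a - (b + h \<bullet> (u - z))"
      by (rule c(2)) (unfold u_def, rule strictly_convex_segment_le[OF conv b a t])
    also have "\<dots> = t * (a - b - h \<bullet> (x - z))"
      by (simp add: u algebra_simps)
    finally have ct: "c \<le> t * (a - b - h \<bullet> (x - z))" .
    then have "0 \<le> a - b - h \<bullet> (x - z)"
      using c(1) t(1) by (smt (verit) mult_nonneg_nonpos)
    then have "t * (a - b - h \<bullet> (x - z)) \<le> a - b - h \<bullet> (x - z)"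
      using mult_right_mono[of t 1] t by simp
    moreover have "f x + ereal (g \<bullet> (z - x)) \<le> f z"
      using g by (auto simp: subdifferential_def)
    then have "a - b \<le> g \<bullet> (x - z)"
      by (simp add: a b inner_diff_right)
    ultimately show ?thesis
      using ct by (simp add: inner_diff_right inner_commute)
  qed
  with c(1) show ?thesis
    by blast
qed

section \<open>The Lyapunov function along an iteration\<close>

lemma aladin_step_sum_duals:
  assumes N: "N \<ge> 1" and \<rho>: "\<rho> > 0" and step: "aladin_step N f \<rho> z l x z' l'"
  shows "(\<Sum>i=1..N. l' i) = 0"
proof -
  define g where "g = (\<lambda>i. \<rho> *\<^sub>R (z - x i) - l i)"
  have z': "z' = (1 / real N) *\<^sub>R (\<Sum>i=1..N. x i - (1 / \<rho>) *\<^sub>R g i)"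
    and l': "\<And>i. i \<in> {1..N} \<Longrightarrow> l' i = \<rho> *\<^sub>R (x i - z') - g i"
    using step by (auto simp: aladin_step_def Let_def g_def)
  have mean: "real N *\<^sub>R z' = (\<Sum>i=1..N. x i - (1 / \<rho>) *\<^sub>R g i)"
    using N by (simp add: z')
  have "(\<Sum>i=1..N. l' i) = (\<Sum>i=1..N. \<rho> *\<^sub>R (x i - (1 / \<rho>) *\<^sub>R g i) - \<rho> *\<^sub>R z')"
    by (rule sum.cong) (use l' \<rho> in \<open>auto simp: algebra_simps\<close>)
  also have "\<dots> = \<rho> *\<^sub>R (\<Sum>i=1..N. x i - (1 / \<rho>) *\<^sub>R g i) - real N *\<^sub>R (\<rho> *\<^sub>R z')"
    by (simp add: sum_subtractf sum_constant_scaleR flip: scaleR_sum_right)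
  also have "\<dots> = 0"
    unfolding mean[symmetric] by (simp add: mult.commute)
  finally show ?thesis .
qed

text \<open>
  The inner products of \<open>z - zs\<close> with the deviations of the multipliers add up to zero, so either
  sign \<open>\<sigma>\<close> is possible: the minus sign describes the point before a step and the plus sign the point
  after it.
\<close>

lemma lyapunov_sum_squares:
  assumes \<rho>: "\<rho> > 0" and \<sigma>: "\<sigma> = 1 \<or> \<sigma> = - 1"
    and l: "(\<Sum>i=1..N. l i) = 0" and ls: "(\<Sum>i=1..N. ls i) = 0"
  shows "\<rho> * lyapunov N \<rho> zs ls z l
    = (\<Sum>i=1..N. (norm (\<rho> *\<^sub>R (z - zs) + \<sigma> *\<^sub>R (l i - ls i)))\<^sup>2)"
proof -
  have "(norm (\<rho> *\<^sub>R (z - zs) + \<sigma> *\<^sub>R (l i - ls i)))\<^sup>2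
      = \<rho>\<^sup>2 * (norm (z - zs))\<^sup>2 + 2 * \<sigma> * \<rho> * ((z - zs) \<bullet> (l i - ls i)) + (norm (l i - ls i))\<^sup>2"
    for i
    using \<sigma> unfolding power2_norm_eq_inner inner_add_left inner_add_right inner_scaleR_left
      inner_scaleR_right by (auto simp: inner_commute power2_eq_square algebra_simps)
  then have "(\<Sum>i=1..N. (norm (\<rho> *\<^sub>R (z - zs) + \<sigma> *\<^sub>R (l i - ls i)))\<^sup>2)
      = real N * (\<rho>\<^sup>2 * (norm (z - zs))\<^sup>2) + 2 * \<sigma> * \<rho> * ((z - zs) \<bullet> (\<Sum>i=1..N. l i - ls i))
        + (\<Sum>i=1..N. (norm (l i - ls i))\<^sup>2)"
    by (simp only: sum.distrib inner_sum_right sum_distrib_left) simp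
  also have "(\<Sum>i=1..N. l i - ls i) = 0"
    unfolding sum_subtractf l ls by simp
  finally show ?thesis
    using \<rho> by (simp add: lyapunov_def distrib_left power2_eq_square)
qed

lemma lyapunov_decrease:
  assumes N: "N \<ge> 1" and \<rho>: "\<rho> > 0" and step: "aladin_step N f \<rho> z l x z' l'"
    and l: "(\<Sum>i=1..N. l i) = 0" and ls: "(\<Sum>i=1..N. ls i) = 0"
  shows "lyapunov N \<rho> zs ls z l - lyapunov N \<rho> zs ls z' l'
    = 4 * (\<Sum>i=1..N. (x i - zs) \<bullet> (\<rho> *\<^sub>R (z - x i) - l i + ls i))"
    (is "?L - ?L' = 4 * ?S")
proof -
  define a where "a = (\<lambda>i. \<rho> *\<^sub>R (x i - zs))"
  define b where "b = (\<lambda>i. \<rho> *\<^sub>R (z - x i) - l i + ls i)"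
  have l': "l' i = \<rho> *\<^sub>R (x i - z') - (\<rho> *\<^sub>R (z - x i) - l i)" if "i \<in> {1..N}" for i
    using step that by (auto simp: aladin_step_def Let_def)
  have "\<rho> * ?L = (\<Sum>i=1..N. (norm (\<rho> *\<^sub>R (z - zs) + (- 1) *\<^sub>R (l i - ls i)))\<^sup>2)"
    by (rule lyapunov_sum_squares[OF \<rho> _ l ls]) simp
  also have "\<dots> = (\<Sum>i=1..N. (norm (a i + b i))\<^sup>2)"
    by (simp add: a_def b_def algebra_simps)
  finally have before: "\<rho> * ?L = (\<Sum>i=1..N. (norm (a i + b i))\<^sup>2)" .
  have "\<rho> * ?L' = (\<Sum>i=1..N. (norm (\<rho> *\<^sub>R (z' - zs) + 1 *\<^sub>R (l' i - ls i)))\<^sup>2)"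
    by (rule lyapunov_sum_squares[OF \<rho> _ aladin_step_sum_duals[OF N \<rho> step] ls]) simp
  also have "\<dots> = (\<Sum>i=1..N. (norm (a i - b i))\<^sup>2)"
    by (rule sum.cong) (simp_all add: l' a_def b_def algebra_simps)
  finally have after: "\<rho> * ?L' = (\<Sum>i=1..N. (norm (a i - b i))\<^sup>2)" .
  have "\<rho> * (?L - ?L') = (\<Sum>i=1..N. (norm (a i + b i))\<^sup>2 - (norm (a i - b i))\<^sup>2)"
    by (simp add: right_diff_distrib before after sum_subtractf)
  also have "\<dots> = (\<Sum>i=1..N. \<rho> * (4 * ((x i - zs) \<bullet> b i)))"
    by (rule sum.cong)
      (simp_all add: power2_norm_eq_inner inner_add_left inner_add_right inner_diff_left
        inner_diff_right inner_commute a_def algebra_simps)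
  also have "\<dots> = \<rho> * (4 * ?S)"
    by (simp add: b_def sum_distrib_left)
  finally show ?thesis
    using \<rho> by simp
qed

section \<open>Convergence of the local iterates\<close>

theorem theorem4:
  fixes f :: "nat \<Rightarrow> real ^ 'n \<Rightarrow> ereal"
    and N :: nat and \<rho> :: real
    and zs :: "real ^ 'n" and ls :: "nat \<Rightarrow> real ^ 'n"
  assumes "N \<ge> 1" and "\<rho> > 0"
    and "\<And>i. i \<in> {1..N} \<Longrightarrow> closed_fun (f i)"
    and "\<And>i. i \<in> {1..N} \<Longrightarrow> proper_fun (f i)"
    and "\<And>i. i \<in> {1..N} \<Longrightarrow> strictly_convex_fun (f i)"
    and "consensus_solution N f zs"
    and "optimal_duals N f zs ls"
  shows "\<exists>\<alpha>. class_K \<alpha> \<and>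
    (\<forall>z l x. aladin_run N f \<rho> z l x \<longrightarrow>
       (\<forall>k. \<forall>i\<in>{1..N}.
          lyapunov N \<rho> zs ls (z k) (l k) - lyapunov N \<rho> zs ls (z (Suc k)) (l (Suc k))
            \<ge> \<alpha> (norm (x k i - zs)) \<and>
          \<alpha> (norm (x k i - zs)) \<ge> 0) \<and>
       (\<forall>i\<in>{1..N}. (\<lambda>k. x k i) \<longlonglongrightarrow> zs))"
proof -
  have h: "- ls i \<in> subdifferential (f i) zs" if "i \<in> {1..N}" for i
    using assms(7) that by (auto simp: optimal_duals_def)
  have ls: "(\<Sum>i=1..N. ls i) = 0"
    using assms(7) by (auto simp: optimal_duals_def)
  define P where "P = {(norm (x - zs), (x - zs) \<bullet> (g + ls i)) | i x g.
    i \<in> {1..N} \<and> g \<in> subdifferential (f i) x}"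
  have mono: "0 \<le> (x - zs) \<bullet> (g + ls i)"
    if "i \<in> {1..N}" "g \<in> subdifferential (f i) x" for i x g
    using subdifferential_monotone[OF assms(4) that(2) h] that(1) by simp
  have "\<exists>\<alpha>. class_K \<alpha> \<and> (\<forall>(s, d)\<in>P. \<alpha> s \<le> d)"
  proof (rule class_K_minorant)
    fix s d assume "(s, d) \<in> P"
    then show "0 \<le> s \<and> 0 \<le> d"
      using mono by (auto simp: P_def)
  next
    fix r :: real assume r: "0 < r"
    have "\<exists>c>0. \<forall>x g. g \<in> subdifferential (f i) x \<longrightarrow> r \<le> norm (x - zs) \<longrightarrow>
        c \<le> (x - zs) \<bullet> (g + ls i)" if i: "i \<in> {1..N}" for i
      using strictly_convex_uniform_monotonicity[OF assms(3-5)[OF i] h[OF i] r] by simp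
    then obtain c where c: "\<And>i. i \<in> {1..N} \<Longrightarrow> c i > 0"
        "\<And>i x g. i \<in> {1..N} \<Longrightarrow> g \<in> subdifferential (f i) x \<Longrightarrow> r \<le> norm (x - zs) \<Longrightarrow>
          c i \<le> (x - zs) \<bullet> (g + ls i)"
      by metis
    have "Min (c ` {1..N}) > 0"
      using c(1) assms(1) by (subst Min_gr_iff) auto
    moreover have "Min (c ` {1..N}) \<le> d" if sd: "(s, d) \<in> P" "r \<le> s" for s d
    proof -
      obtain i x g where i: "i \<in> {1..N}" "g \<in> subdifferential (f i) x" "s = norm (x - zs)"
          "d = (x - zs) \<bullet> (g + ls i)"
        using sd(1) by (auto simp: P_def)
      have "Min (c ` {1..N}) \<le> c i"
        using i(1) by (intro Min_le) auto
      also have "\<dots> \<le> d"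
        using c(2)[OF i(1,2)] sd(2) i(3,4) by simp
      finally show ?thesis .
    qed
    ultimately show "\<exists>c>0. \<forall>(s, d)\<in>P. r \<le> s \<longrightarrow> c \<le> d"
      by blast
  qed
  then obtain \<alpha> where K: "class_K \<alpha>" and \<alpha>: "\<And>s d. (s, d) \<in> P \<Longrightarrow> \<alpha> s \<le> d"
    by blast
  have \<alpha>_bound: "\<alpha> (norm (x - zs)) \<le> (x - zs) \<bullet> (g + ls i)"
    if "i \<in> {1..N}" "g \<in> subdifferential (f i) x" for i x g
    by (rule \<alpha>) (use that in \<open>auto simp: P_def\<close>)
  have decrease:
    "\<alpha> (norm (x k i - zs))
      \<le> lyapunov N \<rho> zs ls (z k) (l k) - lyapunov N \<rho> zs ls (z (Suc k)) (l (Suc k))"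
    if run: "aladin_run N f \<rho> z l x" and i: "i \<in> {1..N}" for z l x k i
  proof -
    have step: "aladin_step N f \<rho> (z k) (l k) (x k) (z (Suc k)) (l (Suc k))" for k
      using run by (auto simp: aladin_run_def)
    have l: "(\<Sum>i=1..N. l k i) = 0"
      using run aladin_step_sum_duals[OF assms(1,2) step] by (cases k) (auto simp: aladin_run_def)
    define g where "g = (\<lambda>i. \<rho> *\<^sub>R (z k - x k i) - l k i)"
    have g: "g j \<in> subdifferential (f j) (x k j)" if j: "j \<in> {1..N}" for j
      unfolding g_def
      by (rule proximal_optimality[OF assms(4,5)[OF j]])
        (use step[of k] j in \<open>auto simp: aladin_step_def Let_def\<close>)
    define S where "S = (\<Sum>j=1..N. (x k j - zs) \<bullet> (g j + ls j))"
    have "\<alpha> (norm (x k i - zs)) \<le> (x k i - zs) \<bullet> (g i + ls i)"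
      by (rule \<alpha>_bound[OF i g[OF i]])
    also have "\<dots> \<le> S"
      unfolding S_def
      by (rule member_le_sum[OF i]) (use mono g in auto)
    also have "0 \<le> S"
      unfolding S_def by (rule sum_nonneg) (use mono g in auto)
    then have "S \<le> 4 * S"
      by simp
    also have "4 * S
        = lyapunov N \<rho> zs ls (z k) (l k) - lyapunov N \<rho> zs ls (z (Suc k)) (l (Suc k))"
      unfolding S_def g_def by (rule lyapunov_decrease[OF assms(1,2) step l ls, symmetric])
    finally show ?thesis .
  qed
  have "(\<lambda>k. x k i) \<longlonglongrightarrow> zs" if run: "aladin_run N f \<rho> z l x" and i: "i \<in> {1..N}" for z l x i
  proof -
    have "(\<lambda>k. \<alpha> (norm (x k i - zs))) \<longlonglongrightarrow> 0"
    proof (rule decrements_bound_tendsto_zero)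
      show "0 \<le> lyapunov N \<rho> zs ls (z k) (l k)" for k
        unfolding lyapunov_def using assms(2)
        by (intro add_nonneg_nonneg mult_nonneg_nonneg sum_nonneg) auto
    qed (use class_K_nonneg[OF K] decrease[OF run i] in auto)
    then have "(\<lambda>k. norm (x k i - zs)) \<longlonglongrightarrow> 0"
      by (rule class_K_tendsto_zeroD[OF K norm_ge_zero])
    then show ?thesis
      by (simp add: LIM_zero_iff tendsto_norm_zero_iff)
  qed
  then show ?thesis
    using K decrease class_K_nonneg[OF K norm_ge_zero] by blast
qed

end
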